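(* Let $\alpha>1$ and let $\rho,\kappa,\mu_1,\mu_2,\mu_3,\eta,\delta,\Omega_\delta$ be as in the context; in particular $\rho_{j,j'}-\kappa_{j,j'}>2$ for all $j,j'$, $0\le\eta<\min\{2(\frac1\nu-\mu_1)\eta_2-\mu_2,\ \eta_3\}$ and $\delta\sim\varepsilon^{1+\eta}$. Let $0<\varepsilon\ll1$ and $\omega\notin\Omega_\delta$. Then there exists a positive time $T_\varepsilon$ of order $\varepsilon^{-\alpha+1+\eta}$ (that is, $T_\varepsilon=c_*\varepsilon^{-\alpha+1+\eta}$ with $c_*>0$ independent of $\varepsilon$ and $\omega$) and a randomized spatially quasi-periodic solution $$u(t,x)=\sum_{n\in\mathbb Z^\nu}c(t,n)\,e^{\mathrm i\theta_n(x)},\qquad t\in[0,T_\varepsilon],\ x\in\mathbb R^d,$$ of the Cauchy problem $$\mathrm i\partial_tu+\Delta u+\varepsilon^\alpha|u|^2u=0,\qquad u(0,x)=\sum_{n\in\mathbb Z^\nu}c(n)\,g_n\,e^{\mathrm i\theta_n(x)},$$ whose Fourier coefficients satisfy $$\sup_{t\in[0,T_\varepsilon]}|c(t,n)|\lesssim\varepsilon^{-\frac12-\frac\eta2}\,w_{-\frac{\rho-\kappa}{2}}(n)\qquad\text{for all }n\in\mathbb Z^\nu,$$ with implied constant independent of $n$, $\varepsilon$ and $\omega$.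
   Context: Let $d\ge1$, let $\nu_1,\dots,\nu_d\ge1$ be integers and $\nu=\sum_{j=1}^d\nu_j>d$. Write $n\in\mathbb Z^\nu$ as $n=(n_1,\dots,n_d)$ with $n_j=(n_{j,1},\dots,n_{j,\nu_j})\in\mathbb Z^{\nu_j}$. For each $j$ fix a frequency vector $\omega_j\in\mathbb R^{\nu_j}$ that is rationally independent: $\langle m,\omega_j\rangle=0$ with $m\in\mathbb Z^{\nu_j}$ implies $m=0$. For $x\in\mathbb R^d$ put $\theta_n(x)=\sum_{j=1}^d\langle n_j,\omega_j\rangle x_j$, and put $Q(n)=\sum_{j=1}^d\langle n_j,\omega_j\rangle^2$. For a vector of real exponents $\tau=(\tau_{j,j'})_{1\le j\le d,\,1\le j'\le\nu_j}$ set $w_\tau(n)=\prod_{j=1}^d\prod_{j'=1}^{\nu_j}(1+|n_{j,j'}|)^{\tau_{j,j'}}$. Random data: $c:\mathbb Z^\nu\to\mathbb C$ is deterministic with $|c(n)|\le w_{-\rho}(n)$, where all $\rho_{j,j'}>0$. On a probability space $(\Omega,\mathcal F,\mathbb P)$, $(g_n)_{n\in\mathbb Z^\nu}$ are i.i.d. standard complex Gaussian variables (real and imaginary parts independent $\mathcal N(0,\frac12)$). Parameters: $\kappa=(\kappa_{j,j'})$ with all $\kappa_{j,j'}>0$ and $\rho_{j,j'}-\kappa_{j,j'}>2$; $0<\mu_1\ll 1/\nu$, $0<\mu_2\ll1$, $0<\mu_3\ll1$ are fixed small constants (in particular $\mu_1<1/\nu$); $\eta_2=\sum_{j=1}^d\sum_{j'=1}^{\nu_j}(\rho_{j,j'}-\kappa_{j,j'}-1)$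 and $\eta_3=\frac23(\alpha-1)-\frac{\mu_3}{3}$. The relation $\delta\sim\varepsilon^{1+\eta}$ means $a^{-1}\varepsilon^{1+\eta}\le\delta\le a\,\varepsilon^{1+\eta}$ for a fixed $a\ge1$. The exceptional set is $$\Omega_\delta=\bigcup_{n\in\mathbb Z^\nu}\{\omega\in\Omega:|g_n(\omega)|>\delta^{-1/2}w_\kappa(n)\}.$$ Solutions are understood through their Fourier coefficients: for all $n\in\mathbb Z^\nu$ and $t\in[0,T_\varepsilon]$, $$c(t,n)=e^{-\mathrm iQ(n)t}c(n)g_n+\mathrm i\varepsilon^\alpha\int_0^te^{-\mathrm iQ(n)(t-s)}\sum_{n^1-n^2+n^3=n}c(s,n^1)\overline{c(s,n^2)}c(s,n^3)\,ds .$$ *)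

theory Defs
  imports "HOL-Probability.Probability"
begin

text \<open>
  The spatial dimension \<open>d\<close> is \<open>CARD('d)\<close>, and \<open>\<nu> j\<close> is the length of the \<open>j\<close>-th block. An
  element of \<open>\<int>\<^sup>\<nu>\<close>, a frequency vector or an exponent vector is a function of \<open>j\<close> and of
  \<open>j' \<in> {1..\<nu> j}\<close>. Only the entries in that range matter; lattice points are normalised to vanish
  outside it, so that each point of \<open>\<int>\<^sup>\<nu>\<close> is represented exactly once.
\<close>

definition index_lattice :: "('d::finite \<Rightarrow> nat) \<Rightarrow> ('d \<Rightarrow> nat \<Rightarrow> int) set" where
  "index_lattice \<nu> = {n. \<forall>j j'. j' \<notin> {1..\<nu> j} \<longrightarrow> n j j' = 0}"

definition block_inner ::
  "('d::finite \<Rightarrow> nat) \<Rightarrow> ('d \<Rightarrow> nat \<Rightarrow> real) \<Rightarrow> ('d \<Rightarrow> nat \<Rightarrow> int) \<Rightarrow> 'd \<Rightarrow> real" where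
  "block_inner \<nu> \<omega> n j = (\<Sum>j'=1..\<nu> j. real_of_int (n j j') * \<omega> j j')"

definition rationally_independent :: "nat \<Rightarrow> (nat \<Rightarrow> real) \<Rightarrow> bool" where
  "rationally_independent k v \<longleftrightarrow>
     (\<forall>m :: nat \<Rightarrow> int. (\<Sum>i=1..k. real_of_int (m i) * v i) = 0 \<longrightarrow> (\<forall>i\<in>{1..k}. m i = 0))"

definition phase ::
  "('d::finite \<Rightarrow> nat) \<Rightarrow> ('d \<Rightarrow> nat \<Rightarrow> real) \<Rightarrow> ('d \<Rightarrow> nat \<Rightarrow> int) \<Rightarrow> real ^ 'd \<Rightarrow> real" where
  "phase \<nu> \<omega> n x = (\<Sum>j\<in>UNIV. block_inner \<nu> \<omega> n j * x $ j)"

definition dispersion ::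
  "('d::finite \<Rightarrow> nat) \<Rightarrow> ('d \<Rightarrow> nat \<Rightarrow> real) \<Rightarrow> ('d \<Rightarrow> nat \<Rightarrow> int) \<Rightarrow> real" where
  "dispersion \<nu> \<omega> n = (\<Sum>j\<in>UNIV. (block_inner \<nu> \<omega> n j)\<^sup>2)"

definition weight ::
  "('d::finite \<Rightarrow> nat) \<Rightarrow> ('d \<Rightarrow> nat \<Rightarrow> real) \<Rightarrow> ('d \<Rightarrow> nat \<Rightarrow> int) \<Rightarrow> real" where
  "weight \<nu> \<tau> n = (\<Prod>j\<in>UNIV. \<Prod>j'=1..\<nu> j. (1 + \<bar>real_of_int (n j j')\<bar>) powr \<tau> j j')"

definition eta2 ::
  "('d::finite \<Rightarrow> nat) \<Rightarrow> ('d \<Rightarrow> nat \<Rightarrow> real) \<Rightarrow> ('d \<Rightarrow> nat \<Rightarrow> real) \<Rightarrow> real" where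
  "eta2 \<nu> \<rho> \<kappa> = (\<Sum>j\<in>UNIV. \<Sum>j'=1..\<nu> j. (\<rho> j j' - \<kappa> j j' - 1))"

definition eta3 :: "real \<Rightarrow> real \<Rightarrow> real" where
  "eta3 \<alpha> \<mu>\<^sub>3 = 2 / 3 * (\<alpha> - 1) - \<mu>\<^sub>3 / 3"

text \<open>The second parameter of \<^const>\<open>normal_density\<close> is the standard deviation, so
  \<open>sqrt (1/2)\<close> is variance \<open>1/2\<close>.\<close>

definition std_complex_gaussian :: "'w measure \<Rightarrow> ('w \<Rightarrow> complex) \<Rightarrow> bool" where
  "std_complex_gaussian M X \<longleftrightarrow>
     X \<in> borel_measurable M \<and>
     prob_space.indep_var M borel (\<lambda>w. Re (X w)) borel (\<lambda>w. Im (X w)) \<and>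
     distributed M lborel (\<lambda>w. Re (X w)) (normal_density 0 (sqrt (1/2))) \<and>
     distributed M lborel (\<lambda>w. Im (X w)) (normal_density 0 (sqrt (1/2)))"

definition exceptional_set ::
  "'w measure \<Rightarrow> ('d::finite \<Rightarrow> nat) \<Rightarrow> ('d \<Rightarrow> nat \<Rightarrow> real) \<Rightarrow>
   (('d \<Rightarrow> nat \<Rightarrow> int) \<Rightarrow> 'w \<Rightarrow> complex) \<Rightarrow> real \<Rightarrow> 'w set" where
  "exceptional_set M \<nu> \<kappa> g \<delta> =
     (\<Union>n\<in>index_lattice \<nu>. {w \<in> space M. cmod (g n w) > \<delta> powr (- 1 / 2) * weight \<nu> \<kappa> n})"

definition convolution_triples ::
  "('d::finite \<Rightarrow> nat) \<Rightarrow> ('d \<Rightarrow> nat \<Rightarrow> int) \<Rightarrow>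
   (('d \<Rightarrow> nat \<Rightarrow> int) \<times> ('d \<Rightarrow> nat \<Rightarrow> int) \<times> ('d \<Rightarrow> nat \<Rightarrow> int)) set" where
  "convolution_triples \<nu> n =
     {(n1, n2, n3). n1 \<in> index_lattice \<nu> \<and> n2 \<in> index_lattice \<nu> \<and> n3 \<in> index_lattice \<nu> \<and>
        (\<forall>j j'. n1 j j' - n2 j j' + n3 j j' = n j j')}"

definition cubic_term ::
  "(('d::finite \<Rightarrow> nat \<Rightarrow> int) \<Rightarrow> complex) \<Rightarrow>
   ('d \<Rightarrow> nat \<Rightarrow> int) \<times> ('d \<Rightarrow> nat \<Rightarrow> int) \<times> ('d \<Rightarrow> nat \<Rightarrow> int) \<Rightarrow> complex" where
  "cubic_term b = (\<lambda>(n1, n2, n3). b n1 * cnj (b n2) * b n3)"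

definition cubic_sum ::
  "('d::finite \<Rightarrow> nat) \<Rightarrow> (('d \<Rightarrow> nat \<Rightarrow> int) \<Rightarrow> complex) \<Rightarrow> ('d \<Rightarrow> nat \<Rightarrow> int) \<Rightarrow> complex" where
  "cubic_sum \<nu> b n = (\<Sum>\<^sub>\<infinity>p\<in>convolution_triples \<nu> n. cubic_term b p)"

text \<open>
  \<open>u\<close>, with Fourier coefficients \<open>c\<close>, is a spatially quasi-periodic solution on \<open>[0, T]\<close> of
  \<open>\<i> \<partial>\<^sub>t u + \<Delta> u + \<epsilon>\<^sup>\<alpha> |u|\<^sup>2 u = 0\<close> whose initial datum has Fourier coefficients \<open>b\<close>. The equation
  is understood as the Duhamel formula for every Fourier coefficient. Since \<^const>\<open>infsum\<close> and
  \<^const>\<open>integral\<close> are \<open>0\<close> on divergent input, convergence of the sums and integrals is part of the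
  definition.
\<close>

definition qp_nls_solution ::
  "('d::finite \<Rightarrow> nat) \<Rightarrow> ('d \<Rightarrow> nat \<Rightarrow> real) \<Rightarrow> real \<Rightarrow> real \<Rightarrow> (('d \<Rightarrow> nat \<Rightarrow> int) \<Rightarrow> complex) \<Rightarrow>
   real \<Rightarrow> (real \<Rightarrow> real ^ 'd \<Rightarrow> complex) \<Rightarrow> (real \<Rightarrow> ('d \<Rightarrow> nat \<Rightarrow> int) \<Rightarrow> complex) \<Rightarrow> bool" where
  "qp_nls_solution \<nu> \<omega> \<alpha> \<epsilon> b T u c \<longleftrightarrow>
     (\<forall>t\<in>{0..T}. \<forall>x. ((\<lambda>n. c t n * cis (phase \<nu> \<omega> n x)) has_sum u t x) (index_lattice \<nu>)) \<and>
     (\<forall>x. ((\<lambda>n. b n * cis (phase \<nu> \<omega> n x)) has_sum u 0 x) (index_lattice \<nu>)) \<and>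
     (\<forall>t\<in>{0..T}. \<forall>n\<in>index_lattice \<nu>. cubic_term (c t) summable_on convolution_triples \<nu> n) \<and>
     (\<forall>t\<in>{0..T}. \<forall>n\<in>index_lattice \<nu>.
        (\<lambda>s. cis (- dispersion \<nu> \<omega> n * (t - s)) * cubic_sum \<nu> (c s) n)
          absolutely_integrable_on {0..t} \<and>
        c t n = cis (- dispersion \<nu> \<omega> n * t) * b n +
          \<i> * complex_of_real (\<epsilon> powr \<alpha>) *
          integral {0..t} (\<lambda>s. cis (- dispersion \<nu> \<omega> n * (t - s)) * cubic_sum \<nu> (c s) n))"

end

theory Submission
  imports Defs
begin

text \<open>
  Off the exceptional set the initial Fourier coefficients are at most \<open>B W(n)\<close>, where
  \<open>B = \<surd>a \<epsilon>\<^bsup>-(1+\<eta>)/2\<^esup>\<close> and \<open>W(n) = w\<^bsub>-(\<rho>-\<kappa>)/2\<^esub>(n)\<close>. All exponents of \<open>W\<close> exceed 1, so \<open>W\<close> is summable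
  and its cubic convolution is at most \<open>K W\<close>. Hence the Duhamel map sends the ball
  \<open>\<bar>c(t,n)\<bar> \<le> 2 B W(n)\<close> into itself and halves weighted distances as soon as
  \<open>24 \<epsilon>\<^sup>\<alpha> T B\<^sup>2 K \<le> 1\<close>, which is \<open>T = \<epsilon>\<^bsup>-\<alpha>+1+\<eta>\<^esup> / (24 a K)\<close>; its Picard iterates converge to the solution.
\<close>

section \<open>Cubic sums in an abstract weighted sup-norm space\<close>

definition weight_product ::
  "(('d::finite \<Rightarrow> nat \<Rightarrow> int) \<Rightarrow> real) \<Rightarrow>
   ('d \<Rightarrow> nat \<Rightarrow> int) \<times> ('d \<Rightarrow> nat \<Rightarrow> int) \<times> ('d \<Rightarrow> nat \<Rightarrow> int) \<Rightarrow> real" where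
  "weight_product W = (\<lambda>(n1, n2, n3). W n1 * W n2 * W n3)"

text \<open>With \<open>e\<close> equal to \<epsilon> to the power \<alpha>, a fixed point on [0, T]
  is a family of coefficients satisfying the integral equation in
  \<open>qp_nls_solution\<close>.\<close>

definition duhamel ::
  "('d::finite \<Rightarrow> nat) \<Rightarrow> ('d \<Rightarrow> nat \<Rightarrow> real) \<Rightarrow> real \<Rightarrow> (('d \<Rightarrow> nat \<Rightarrow> int) \<Rightarrow> complex) \<Rightarrow>
   (real \<Rightarrow> ('d \<Rightarrow> nat \<Rightarrow> int) \<Rightarrow> complex) \<Rightarrow> real \<Rightarrow> ('d \<Rightarrow> nat \<Rightarrow> int) \<Rightarrow> complex" where
  "duhamel \<nu> \<omega> e b c t n =
     cis (- dispersion \<nu> \<omega> n * t) * b n + \<i> * complex_of_real e *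
       integral {0..t} (\<lambda>s. cis (- dispersion \<nu> \<omega> n * (t - s)) * cubic_sum \<nu> (c s) n)"

text \<open>Isolates what the fixed point argument needs from the weight: cubic convolution
  reproduces \<open>W\<close> up to the factor \<open>K\<close>. The product form of the concrete
  weight enters only when the locale is instantiated.\<close>

locale cubic_weight =
  fixes \<nu> :: "'d::finite \<Rightarrow> nat"
    and W :: "('d \<Rightarrow> nat \<Rightarrow> int) \<Rightarrow> real"
    and K :: real
  assumes W_nonneg: "n \<in> index_lattice \<nu> \<Longrightarrow> 0 \<le> W n"
    and K_nonneg: "0 \<le> K"
    and summable_weight_product:
      "n \<in> index_lattice \<nu> \<Longrightarrow> weight_product W summable_on convolution_triples \<nu> n"
    and infsum_weight_product:
      "n \<in> index_lattice \<nu> \<Longrightarrow> infsum (weight_product W) (convolution_triples \<nu> n) \<le> K * W n"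
begin

text \<open>A ball in the sup norm weighted by 1/W. The multiplied form avoids dividing by
  \<open>W\<close>, which is only assumed to be nonnegative.\<close>

definition bounded_by :: "real \<Rightarrow> (('d \<Rightarrow> nat \<Rightarrow> int) \<Rightarrow> complex) \<Rightarrow> bool" where
  "bounded_by R b \<longleftrightarrow> (\<forall>n\<in>index_lattice \<nu>. cmod (b n) \<le> R * W n)"

lemma bounded_byD: "bounded_by R b \<Longrightarrow> n \<in> index_lattice \<nu> \<Longrightarrow> cmod (b n) \<le> R * W n"
  by (simp add: bounded_by_def)

lemma bounded_by_zero: "0 \<le> R \<Longrightarrow> bounded_by R (\<lambda>n. 0)"
  by (simp add: bounded_by_def W_nonneg)

text \<open>Replace the three factors one at a time. Each of the three resulting products has one
  difference, of size \<open>D\<close>, and two factors of size \<open>R\<close>, which explains the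
  constant 3.\<close>

lemma cubic_term_diff_bound:
  assumes b: "bounded_by R b" and b': "bounded_by R b'" and d: "bounded_by D (\<lambda>n. b n - b' n)"
    and "0 \<le> R" "0 \<le> D" and p: "p \<in> convolution_triples \<nu> n"
  shows "cmod (cubic_term b p - cubic_term b' p) \<le> 3 * R\<^sup>2 * D * weight_product W p"
proof -
  obtain x y z where p_eq: "p = (x, y, z)"
    and L: "x \<in> index_lattice \<nu>" "y \<in> index_lattice \<nu>" "z \<in> index_lattice \<nu>"
    using p by (auto simp: convolution_triples_def)
  have triple: "cmod (u * v * w) \<le> (A * W x) * (B * W y) * (C * W z)"
    if "cmod u \<le> A * W x" "cmod v \<le> B * W y" "cmod w \<le> C * W z" "0 \<le> A" "0 \<le> B"
    for u v w A B C
    unfolding norm_mult using that L by (intro mult_mono mult_nonneg_nonneg) (auto simp: W_nonneg)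
  note bounds = bounded_byD[OF b] bounded_byD[OF b'] bounded_byD[OF d]
  have t1: "cmod ((b x - b' x) * cnj (b y) * b z) \<le> (D * W x) * (R * W y) * (R * W z)"
    by (rule triple) (use bounds L assms(4,5) in auto)
  have "cmod (cnj (b y) - cnj (b' y)) = cmod (b y - b' y)"
    by (metis complex_cnj_diff complex_mod_cnj)
  then have t2: "cmod (b' x * (cnj (b y) - cnj (b' y)) * b z) \<le> (R * W x) * (D * W y) * (R * W z)"
    using bounds L assms(4,5) by (intro triple) auto
  have t3: "cmod (b' x * cnj (b' y) * (b z - b' z)) \<le> (R * W x) * (R * W y) * (D * W z)"
    by (rule triple) (use bounds L assms(4,5) in auto)
  have "cubic_term b p - cubic_term b' p =
      (b x - b' x) * cnj (b y) * b z + b' x * (cnj (b y) - cnj (b' y)) * b z +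
      b' x * cnj (b' y) * (b z - b' z)"
    by (simp add: p_eq cubic_term_def algebra_simps)
  then have "cmod (cubic_term b p - cubic_term b' p) \<le> cmod ((b x - b' x) * cnj (b y) * b z) +
      cmod (b' x * (cnj (b y) - cnj (b' y)) * b z) + cmod (b' x * cnj (b' y) * (b z - b' z))"
    by (auto intro!: norm_triangle_le add_right_mono norm_triangle_ineq)
  also have "\<dots> \<le> (D * W x) * (R * W y) * (R * W z) + (R * W x) * (D * W y) * (R * W z) +
      (R * W x) * (R * W y) * (D * W z)"
    by (intro add_mono t1 t2 t3)
  also have "\<dots> = 3 * R\<^sup>2 * D * weight_product W p"
    by (simp add: p_eq weight_product_def power2_eq_square)
  finally show ?thesis .
qed

text \<open>Comparison with the zero sequence, at distance \<open>D\<close> = \<open>R\<close>. The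
  factor 3 is inherited from the difference bound, so that one constant serves both
  estimates.\<close>

lemma cubic_term_bound:
  assumes "bounded_by R b" "0 \<le> R" "p \<in> convolution_triples \<nu> n"
  shows "cmod (cubic_term b p) \<le> 3 * R ^ 3 * weight_product W p"
  using cubic_term_diff_bound[OF assms(1) bounded_by_zero, of R p n] assms
  by (simp add: cubic_term_def split_def power2_eq_square power3_eq_cube mult_ac)

lemma cubic_term_summable:
  assumes "bounded_by R b" "0 \<le> R" "n \<in> index_lattice \<nu>"
  shows "cubic_term b summable_on convolution_triples \<nu> n"
proof (rule Infinite_Sum.abs_summable_summable, rule Infinite_Sum.abs_summable_on_comparison_test')
  show "(\<lambda>p. 3 * R ^ 3 * weight_product W p) summable_on convolution_triples \<nu> n"
    by (intro summable_on_cmult_right summable_weight_product assms)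
qed (rule cubic_term_bound[OF assms(1,2)])

lemma cubic_sum_diff_bound:
  assumes "bounded_by R b" "bounded_by R b'" "bounded_by D (\<lambda>n. b n - b' n)"
    and "0 \<le> R" "0 \<le> D" and n: "n \<in> index_lattice \<nu>"
  shows "cmod (cubic_sum \<nu> b n - cubic_sum \<nu> b' n) \<le> 3 * R\<^sup>2 * D * K * W n"
proof -
  have "((\<lambda>p. cubic_term b p - cubic_term b' p) has_sum (cubic_sum \<nu> b n - cubic_sum \<nu> b' n))
      (convolution_triples \<nu> n)"
    unfolding cubic_sum_def
    using has_sum_add[OF has_sum_infsum[OF cubic_term_summable[OF assms(1,4) n]]
        has_sum_uminusI[OF has_sum_infsum[OF cubic_term_summable[OF assms(2,4) n]]]] by simp
  moreover have "((\<lambda>p. 3 * R\<^sup>2 * D * weight_product W p) has_sum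
      3 * R\<^sup>2 * D * infsum (weight_product W) (convolution_triples \<nu> n)) (convolution_triples \<nu> n)"
    by (intro has_sum_cmult_right has_sum_infsum summable_weight_product n)
  ultimately have "cmod (cubic_sum \<nu> b n - cubic_sum \<nu> b' n)
      \<le> 3 * R\<^sup>2 * D * infsum (weight_product W) (convolution_triples \<nu> n)"
    by (rule norm_infsum_le) (rule cubic_term_diff_bound[OF assms(1-5)])
  also have "\<dots> \<le> 3 * R\<^sup>2 * D * (K * W n)"
    using infsum_weight_product[OF n] assms by (intro mult_left_mono) auto
  finally show ?thesis by (simp add: mult_ac)
qed

lemma cubic_sum_bound:
  assumes "bounded_by R b" "0 \<le> R" "n \<in> index_lattice \<nu>"
  shows "cmod (cubic_sum \<nu> b n) \<le> 3 * R ^ 3 * K * W n"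
proof -
  have "cubic_sum \<nu> (\<lambda>n. 0) n = 0"
    by (simp add: cubic_sum_def cubic_term_def split_def)
  then show ?thesis
    using cubic_sum_diff_bound[OF assms(1) bounded_by_zero, of R n] assms
    by (simp add: power2_eq_square power3_eq_cube mult_ac)
qed

section \<open>Continuity and bounds for the Duhamel map\<close>

text \<open>Continuity in time is asked of each coefficient separately. Together with the weighted
  bound, uniform in time, this already gives continuity of the cubic sums.\<close>

definition admissible :: "real \<Rightarrow> real \<Rightarrow> (real \<Rightarrow> ('d \<Rightarrow> nat \<Rightarrow> int) \<Rightarrow> complex) \<Rightarrow> bool" where
  "admissible T R c \<longleftrightarrow>
     (\<forall>n\<in>index_lattice \<nu>. continuous_on {0..T} (\<lambda>t. c t n)) \<and> (\<forall>t\<in>{0..T}. bounded_by R (c t))"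

text \<open>Weierstrass M-test: the majorant 3 R^3 \<open>weight_product W\<close> is summable and
  independent of time, and every finite partial sum is continuous.\<close>

lemma continuous_on_cubic_sum:
  assumes c: "admissible T R c" and "0 \<le> R" and n: "n \<in> index_lattice \<nu>"
  shows "continuous_on {0..T} (\<lambda>s. cubic_sum \<nu> (c s) n)"
proof (rule uniform_limit_theorem)
  have "uniform_limit {0..T} (\<lambda>X s. \<Sum>p\<in>X. cubic_term (c s) p)
      (\<lambda>s. \<Sum>\<^sub>\<infinity>p\<in>convolution_triples \<nu> n. cubic_term (c s) p)
      (finite_subsets_at_top (convolution_triples \<nu> n))"
  proof (rule Weierstrass_m_test_general)
    show "cmod (cubic_term (c s) p) \<le> 3 * R ^ 3 * weight_product W p"
      if "p \<in> convolution_triples \<nu> n" "s \<in> {0..T}" for p s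
      using c that by (intro cubic_term_bound[OF _ assms(2)]) (auto simp: admissible_def)
    show "(\<lambda>p. 3 * R ^ 3 * weight_product W p) summable_on convolution_triples \<nu> n"
      by (intro summable_on_cmult_right summable_weight_product n)
  qed
  then show "uniform_limit {0..T} (\<lambda>X s. \<Sum>p\<in>X. cubic_term (c s) p)
      (\<lambda>s. cubic_sum \<nu> (c s) n) (finite_subsets_at_top (convolution_triples \<nu> n))"
    by (simp add: cubic_sum_def)
  show "\<forall>\<^sub>F X in finite_subsets_at_top (convolution_triples \<nu> n).
      continuous_on {0..T} (\<lambda>s. \<Sum>p\<in>X. cubic_term (c s) p)"
  proof (rule eventually_finite_subsets_at_top_weakI)
    fix X assume "X \<subseteq> convolution_triples \<nu> n"
    then show "continuous_on {0..T} (\<lambda>s. \<Sum>p\<in>X. cubic_term (c s) p)"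
      using c by (auto simp: cubic_term_def convolution_triples_def admissible_def split_def
          intro!: continuous_intros)
  qed
qed simp

lemma continuous_on_integrand:
  assumes "admissible T R c" "0 \<le> R" "n \<in> index_lattice \<nu>" "t \<in> {0..T}"
  shows "continuous_on {0..t} (\<lambda>s. cis (- dispersion \<nu> \<omega> n * (t - s)) * cubic_sum \<nu> (c s) n)"
proof -
  have "continuous_on {0..t} (\<lambda>s. cubic_sum \<nu> (c s) n)"
    using assms(4) by (intro continuous_on_subset[OF continuous_on_cubic_sum[OF assms(1-3)]]) auto
  then show ?thesis by (intro continuous_intros)
qed

text \<open>The time \<open>t\<close> occurs both as endpoint and inside the kernel. Splitting the
  exponential moves the \<open>t\<close>-dependent phase out of the integral and leaves an
  indefinite integral of a continuous function.\<close>

lemma continuous_on_duhamel: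
  assumes "admissible T R c" "0 \<le> R" "n \<in> index_lattice \<nu>"
  shows "continuous_on {0..T} (\<lambda>t. duhamel \<nu> \<omega> e b c t n)"
proof -
  let ?q = "dispersion \<nu> \<omega> n"
  have eq: "integral {0..t} (\<lambda>s. cis (- ?q * (t - s)) * cubic_sum \<nu> (c s) n) =
      cis (- ?q * t) * integral {0..t} (\<lambda>s. cis (?q * s) * cubic_sum \<nu> (c s) n)" for t
  proof -
    have "cis (- ?q * (t - s)) = cis (- ?q * t) * cis (?q * s)" for s
      unfolding cis_mult by (simp add: right_diff_distrib)
    then have "integral {0..t} (\<lambda>s. cis (- ?q * (t - s)) * cubic_sum \<nu> (c s) n) =
        integral {0..t} (\<lambda>s. cis (- ?q * t) * (cis (?q * s) * cubic_sum \<nu> (c s) n))"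
      by (simp only: mult.assoc)
    then show ?thesis by simp
  qed
  have "continuous_on {0..T} (\<lambda>t. integral {0..t} (\<lambda>s. cis (?q * s) * cubic_sum \<nu> (c s) n))"
    by (intro indefinite_integral_continuous_1 integrable_continuous_real continuous_intros
        continuous_on_cubic_sum[OF assms])
  then have "continuous_on {0..T} (\<lambda>t. cis (- ?q * t) * b n + \<i> * complex_of_real e *
      (cis (- ?q * t) * integral {0..t} (\<lambda>s. cis (?q * s) * cubic_sum \<nu> (c s) n)))"
    by (intro continuous_on_add continuous_on_mult continuous_on_const continuous_on_cis continuous_on_id)
  then show ?thesis
    unfolding duhamel_def eq .
qed

text \<open>The kernel is unimodular and the interval has length at most \<open>T\<close>, so
  integration costs a factor \<open>T\<close> on top of the cubic bound.\<close>

lemma duhamel_bound: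
  assumes c: "admissible T R c" and "0 \<le> R" "0 \<le> e" and b: "bounded_by B b" and t: "t \<in> {0..T}"
  shows "bounded_by (B + e * T * (3 * R ^ 3 * K)) (duhamel \<nu> \<omega> e b c t)"
  unfolding bounded_by_def
proof
  fix n assume n: "n \<in> index_lattice \<nu>"
  let ?f = "\<lambda>s. cis (- dispersion \<nu> \<omega> n * (t - s)) * cubic_sum \<nu> (c s) n"
  have "cmod (integral {0..t} ?f) \<le> (3 * R ^ 3 * K * W n) * (t - 0)"
  proof (rule integral_bound)
    fix s assume "s \<in> {0..t}"
    then show "cmod (?f s) \<le> 3 * R ^ 3 * K * W n"
      using c t n cubic_sum_bound[OF _ assms(2) n, of "c s"] by (auto simp: norm_mult admissible_def)
  next
    show "continuous_on {0..t} ?f"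
      by (rule continuous_on_integrand[OF assms(1,2) n t])
  qed (use t in auto)
  also have "\<dots> \<le> (3 * R ^ 3 * K * W n) * T"
    using t assms K_nonneg W_nonneg[OF n] by (intro mult_left_mono) auto
  finally have "e * cmod (integral {0..t} ?f) \<le> e * ((3 * R ^ 3 * K * W n) * T)"
    using assms(3) by (rule mult_left_mono)
  moreover have "cmod (duhamel \<nu> \<omega> e b c t n) \<le> cmod (b n) + e * cmod (integral {0..t} ?f)"
    unfolding duhamel_def using assms(3) by (intro norm_triangle_le) (simp add: norm_mult)
  ultimately show "cmod (duhamel \<nu> \<omega> e b c t n) \<le> (B + e * T * (3 * R ^ 3 * K)) * W n"
    using bounded_byD[OF b n] by (simp add: algebra_simps)
qed

text \<open>Both sides carry the same free evolution of \<open>b\<close>, which cancels; only the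
  integral of the difference of the cubic sums is left.\<close>

lemma duhamel_diff_bound:
  assumes c: "admissible T R c" "admissible T R c'" and "0 \<le> R" "0 \<le> D" "0 \<le> e" and t: "t \<in> {0..T}"
    and d: "\<And>s. s \<in> {0..T} \<Longrightarrow> bounded_by D (\<lambda>n. c s n - c' s n)"
  shows "bounded_by (e * T * (3 * R\<^sup>2 * K) * D)
    (\<lambda>n. duhamel \<nu> \<omega> e b c t n - duhamel \<nu> \<omega> e b c' t n)"
  unfolding bounded_by_def
proof
  fix n assume n: "n \<in> index_lattice \<nu>"
  let ?f = "\<lambda>c s. cis (- dispersion \<nu> \<omega> n * (t - s)) * cubic_sum \<nu> (c s) n"
  have cont: "continuous_on {0..t} (?f c)" "continuous_on {0..t} (?f c')"
    using continuous_on_integrand[OF _ assms(3) n t] c by blast+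
  have "cmod (integral {0..t} (\<lambda>s. ?f c s - ?f c' s)) \<le> (3 * R\<^sup>2 * D * K * W n) * (t - 0)"
  proof (rule integral_bound)
    fix s assume "s \<in> {0..t}"
    then have "s \<in> {0..T}" using t by auto
    then show "cmod (?f c s - ?f c' s) \<le> 3 * R\<^sup>2 * D * K * W n"
      using cubic_sum_diff_bound[OF _ _ d assms(3,4) n, of s] c
      by (auto simp: admissible_def norm_mult simp flip: right_diff_distrib)
  qed (use t cont in \<open>auto intro!: continuous_on_diff\<close>)
  also have "\<dots> \<le> (3 * R\<^sup>2 * D * K * W n) * T"
    using t assms K_nonneg W_nonneg[OF n] by (intro mult_left_mono) auto
  finally have "e * cmod (integral {0..t} (\<lambda>s. ?f c s - ?f c' s)) \<le> e * ((3 * R\<^sup>2 * D * K * W n) * T)"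
    using assms(5) by (rule mult_left_mono)
  moreover have "duhamel \<nu> \<omega> e b c t n - duhamel \<nu> \<omega> e b c' t n =
      \<i> * complex_of_real e * integral {0..t} (\<lambda>s. ?f c s - ?f c' s)"
    using cont by (simp add: duhamel_def integral_diff integrable_continuous_real right_diff_distrib)
  ultimately show "cmod (duhamel \<nu> \<omega> e b c t n - duhamel \<nu> \<omega> e b c' t n)
      \<le> (e * T * (3 * R\<^sup>2 * K) * D) * W n"
    using assms(5) by (simp add: norm_mult mult_ac)
qed

section \<open>Picard iteration\<close>

lemma duhamel_fixed_point:
  assumes b: "bounded_by B b" and "0 \<le> B" "0 \<le> e" "0 \<le> T" and small: "24 * e * T * B\<^sup>2 * K \<le> 1"
  obtains c where "admissible T (2 * B) c"
    and "\<And>t n. t \<in> {0..T} \<Longrightarrow> n \<in> index_lattice \<nu> \<Longrightarrow> c t n = duhamel \<nu> \<omega> e b c t n"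
proof -
  let ?\<Phi> = "duhamel \<nu> \<omega> e b"
  define F where "F k = (?\<Phi> ^^ k) (\<lambda>t n. 0)" for k
  have F_Suc: "F (Suc k) = ?\<Phi> (F k)" for k
    by (simp add: F_def)
  have R: "0 \<le> 2 * B" using assms by simp
  have mono: "bounded_by D' h" if "bounded_by D h" "D \<le> D'" for D D' h
    using that W_nonneg unfolding bounded_by_def by (meson mult_right_mono order_trans)
  have maps: "admissible T (2 * B) (?\<Phi> c)" if c: "admissible T (2 * B) c" for c
    unfolding admissible_def
  proof (intro conjI ballI)
    fix t assume "t \<in> {0..T}"
    then have "bounded_by (B + e * T * (3 * (2 * B) ^ 3 * K)) (?\<Phi> c t)"
      by (intro duhamel_bound[OF c R assms(3) b])
    \<comment> \<open>On the ball of radius 2B the cubic constant is 3 (2B)^3 = 24 B^3. Smallness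
      therefore makes the nonlinear part at most \<open>B\<close>, and adding the datum gives
      2B.\<close>
    moreover have "e * T * (3 * (2 * B) ^ 3 * K) = B * (24 * e * T * B\<^sup>2 * K)"
      by (simp add: power2_eq_square power3_eq_cube)
    then have "B + e * T * (3 * (2 * B) ^ 3 * K) \<le> 2 * B"
      using mult_left_mono[OF small assms(2)] by linarith
    ultimately show "bounded_by (2 * B) (?\<Phi> c t)"
      by (rule mono)
  qed (intro continuous_on_duhamel[OF c R])
  have contracts: "bounded_by (D / 2) (\<lambda>n. ?\<Phi> c t n - ?\<Phi> c' t n)"
    if "admissible T (2 * B) c" "admissible T (2 * B) c'" "0 \<le> D" "t \<in> {0..T}"
      "\<And>s. s \<in> {0..T} \<Longrightarrow> bounded_by D (\<lambda>n. c s n - c' s n)" for c c' D t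
  proof -
    \<comment> \<open>Here 3 (2B)^2 = 12 B^2 is half of 24 B^2, whence the contraction factor
      1/2.\<close>
    have "e * T * (3 * (2 * B)\<^sup>2 * K) * D = 24 * e * T * B\<^sup>2 * K * (D / 2)"
      by (simp add: power2_eq_square)
    also have "\<dots> \<le> D / 2"
      using mult_right_mono[OF small, of "D / 2"] that(3) by simp
    finally show ?thesis
      by (rule mono[OF duhamel_diff_bound[OF that(1,2) R that(3) assms(3) that(4,5)], rotated])
  qed
  have adm: "admissible T (2 * B) (F k)" for k
  proof (induction k)
    case 0
    then show ?case by (simp add: F_def admissible_def bounded_by_zero R)
  next
    case (Suc k)
    then show ?case by (simp add: F_Suc maps)
  qed
  have step: "bounded_by (2 * B / 2 ^ k) (\<lambda>n. F (Suc k) t n - F k t n)" if "t \<in> {0..T}" for k t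
    using that
  proof (induction k arbitrary: t)
    case 0
    \<comment> \<open>The iteration starts at zero, so the first increment is the first iterate
      itself and lies in the ball of radius 2B.\<close>
    then show ?case using adm[of 1] by (simp add: F_def admissible_def)
  next
    case (Suc k)
    have "bounded_by (2 * B / 2 ^ k / 2) (\<lambda>n. ?\<Phi> (F (Suc k)) t n - ?\<Phi> (F k) t n)"
      by (rule contracts[OF adm adm]) (use Suc R in auto)
    then show ?case by (simp add: F_Suc)
  qed
  \<comment> \<open>The increments telescope and \<open>F 0\<close> vanishes, so the partial sums of
    this series are the iterates.\<close>
  define c where "c t n = (\<Sum>k. F (Suc k) t n - F k t n)" for t n
  have geo: "(\<lambda>i. 2 * B / 2 ^ (i + k) * W n) sums (4 * B / 2 ^ k * W n)" for k n
    using sums_mult[OF geometric_sums[of "1/2::real"], of "2 * B / 2 ^ k * W n"]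
    by (simp add: power_add power_divide mult_ac)
  \<comment> \<open>The increments from index k onwards add up to at most 2B/2^k (1 + 1/2 + 1/4 +
    ...) = 4B/2^k.\<close>
  have tail: "bounded_by (4 * B / 2 ^ k) (\<lambda>n. c t n - F k t n)" if t: "t \<in> {0..T}" for k t
    unfolding bounded_by_def
  proof
    fix n assume n: "n \<in> index_lattice \<nu>"
    let ?d = "\<lambda>k. F (Suc k) t n - F k t n"
    have le: "cmod (?d k) \<le> 2 * B / 2 ^ k * W n" for k
      using bounded_byD[OF step[OF t] n] .
    have d: "summable ?d"
      by (rule summable_comparison_test'[OF sums_summable[OF geo[of 0 n]]]) (use le in simp)
    have "c t n = (\<Sum>i. ?d (i + k)) + (\<Sum>i<k. ?d i)"
      unfolding c_def by (rule suminf_split_initial_segment[OF d])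
    moreover have "(\<Sum>i<k. ?d i) = F k t n"
      using sum_lessThan_telescope[of "\<lambda>i. F i t n" k] by (simp add: F_def)
    ultimately have "c t n - F k t n = (\<Sum>i. ?d (i + k))" by simp
    moreover have "cmod (\<Sum>i. ?d (i + k)) \<le> 4 * B / 2 ^ k * W n"
      unfolding sums_unique[OF geo[of k n]]
      by (rule norm_suminf_le[OF _ sums_summable[OF geo]]) (rule le)
    ultimately show "cmod (c t n - F k t n) \<le> 4 * B / 2 ^ k * W n" by simp
  qed
  have tail_tendsto: "(\<lambda>k. C / 2 ^ k * W n) \<longlonglongrightarrow> 0" for C n
    using tendsto_mult[OF LIMSEQ_power_zero[of "1/2::real"] tendsto_const[of "C * W n"]]
    by (simp add: power_divide)
  \<comment> \<open>The tail bound does not depend on time, so for each fixed \<open>n\<close>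
    convergence is uniform in \<open>t\<close> and the limit inherits continuity.\<close>
  have unif: "uniform_limit {0..T} (\<lambda>k t. F k t n) (\<lambda>t. c t n) sequentially"
    if n: "n \<in> index_lattice \<nu>" for n
  proof (rule uniform_limitI)
    fix r :: real assume "r > 0"
    then have "\<forall>\<^sub>F k in sequentially. 4 * B / 2 ^ k * W n < r"
      by (rule order_tendstoD(2)[OF tail_tendsto])
    then show "\<forall>\<^sub>F k in sequentially. \<forall>t\<in>{0..T}. dist (F k t n) (c t n) < r"
    proof eventually_elim
      case (elim k)
      then show ?case
        using bounded_byD[OF tail n, of _ k] by (force simp: dist_norm norm_minus_commute)
    qed
  qed
  have adm_c: "admissible T (2 * B) c"
    unfolding admissible_def bounded_by_def
  proof (intro conjI ballI)
    fix n assume n: "n \<in> index_lattice \<nu>"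
    show "continuous_on {0..T} (\<lambda>t. c t n)"
      by (rule uniform_limit_theorem[OF _ unif[OF n]]) (use adm n in \<open>auto simp: admissible_def\<close>)
  next
    fix t n assume t: "t \<in> {0..T}" and n: "n \<in> index_lattice \<nu>"
    have "(\<lambda>k. F k t n) \<longlonglongrightarrow> c t n"
      using tendsto_uniform_limitI[OF unif[OF n] t] .
    then have "(\<lambda>k. cmod (F k t n)) \<longlonglongrightarrow> cmod (c t n)"
      by (rule tendsto_norm)
    then show "cmod (c t n) \<le> 2 * B * W n"
      using adm t n by (intro LIMSEQ_le_const2) (auto simp: admissible_def bounded_by_def)
  qed
  \<comment> \<open>Both sides are limits of \<open>F (Suc k)\<close>: contraction halves the tail
    bound 4B/2^k, so the image of \<open>F k\<close> tends to the image of \<open>c\<close>.\<close>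
  have "c t n = ?\<Phi> c t n" if t: "t \<in> {0..T}" and n: "n \<in> index_lattice \<nu>" for t n
  proof (rule LIMSEQ_unique)
    show "(\<lambda>k. F (Suc k) t n) \<longlonglongrightarrow> c t n"
      using LIMSEQ_Suc[OF tendsto_uniform_limitI[OF unif[OF n] t]] .
    have "cmod (F (Suc k) t n - ?\<Phi> c t n) \<le> 2 * B / 2 ^ k * W n" for k
    proof -
      have "bounded_by (4 * B / 2 ^ k / 2) (\<lambda>n. ?\<Phi> c t n - ?\<Phi> (F k) t n)"
        by (rule contracts[OF adm_c adm _ t tail]) (use R in auto)
      then show ?thesis
        using bounded_byD[OF _ n] by (fastforce simp: F_Suc norm_minus_commute)
    qed
    then have "(\<lambda>k. F (Suc k) t n - ?\<Phi> c t n) \<longlonglongrightarrow> 0"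
      by (intro Lim_null_comparison[OF _ tail_tendsto[of "2 * B" n]]) auto
    then show "(\<lambda>k. F (Suc k) t n) \<longlonglongrightarrow> ?\<Phi> c t n"
      by (rule LIM_zero_cancel)
  qed
  with adm_c show ?thesis by (rule that)
qed

end

section \<open>Product sums and one-dimensional weights\<close>

text \<open>Injectivity embeds \<open>X\<close> into the finite box spanned by its coordinate
  projections. Enlarging the sum to that box only adds nonnegative terms, and over a box the sum of
  products factorises.\<close>

lemma sum_prod_le_prod_bound:
  fixes f :: "'i \<Rightarrow> 'a \<Rightarrow> real" and \<phi> :: "'x \<Rightarrow> 'i \<Rightarrow> 'a"
  assumes I: "finite I" and X: "finite X"
    and inj: "inj_on (\<lambda>x. restrict (\<phi> x) I) X"
    and nonneg: "\<And>i y. i \<in> I \<Longrightarrow> 0 \<le> f i y"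
    and bound: "\<And>i A. i \<in> I \<Longrightarrow> finite A \<Longrightarrow> sum (f i) A \<le> S i"
  shows "(\<Sum>x\<in>X. \<Prod>i\<in>I. f i (\<phi> x i)) \<le> (\<Prod>i\<in>I. S i)"
proof -
  define A where "A i = (\<lambda>x. \<phi> x i) ` X" for i
  have A: "finite (A i)" for i using X by (simp add: A_def)
  have "(\<Sum>x\<in>X. \<Prod>i\<in>I. f i (\<phi> x i)) =
      (\<Sum>h\<in>(\<lambda>x. restrict (\<phi> x) I) ` X. \<Prod>i\<in>I. f i (h i))"
    by (simp add: sum.reindex[OF inj])
  also have "\<dots> \<le> (\<Sum>h\<in>PiE I A. \<Prod>i\<in>I. f i (h i))"
    using I A nonneg by (intro sum_mono2 finite_PiE prod_nonneg) (auto simp: A_def)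
  also have "\<dots> = (\<Prod>i\<in>I. \<Sum>y\<in>A i. f i y)"
    using I A by (simp add: prod_sum_PiE)
  also have "\<dots> \<le> (\<Prod>i\<in>I. S i)"
    using nonneg bound A by (intro prod_mono) (auto intro: sum_nonneg)
  finally show ?thesis .
qed

definition int_weight :: "real \<Rightarrow> int \<Rightarrow> real" where
  "int_weight s m = (1 + \<bar>real_of_int m\<bar>) powr - s"

lemma int_weight_pos: "0 < int_weight s m"
  by (simp add: int_weight_def)

text \<open>On the nonnegative and on the negative integers the absolute value is injective, so each
  half is dominated by the convergent series with exponent \<open>s\<close>.\<close>

lemma int_weight_sum_bounded:
  assumes "1 < s"
  obtains S where "0 < S" "\<And>A. finite A \<Longrightarrow> sum (int_weight s) A \<le> S"
proof
  \<comment> \<open>The shift by one matches 1 + |m|, so that \<open>m\<close> = 0 corresponds to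
    index 0.\<close>
  define h where "h n = real (Suc n) powr - s" for n
  have h: "summable h"
    unfolding h_def using assms by (subst summable_Suc_iff) (simp add: summable_real_powr_iff)
  have h_pos: "0 < h n" for n by (simp add: h_def)
  show "0 < 2 * suminf h"
    using suminf_pos[OF h] h_pos by simp
  fix A :: "int set"
  assume A: "finite A"
  have half: "sum (int_weight s) B \<le> suminf h" if "B \<subseteq> A" "inj_on (\<lambda>m. nat \<bar>m\<bar>) B" for B
  proof -
    have "sum (int_weight s) B = sum h ((\<lambda>m. nat \<bar>m\<bar>) ` B)"
      unfolding sum.reindex[OF that(2)] by (simp add: int_weight_def h_def add.commute)
    also have "\<dots> \<le> suminf h"
      using A that(1) h h_pos by (intro sum_le_suminf) (auto intro: finite_subset less_imp_le)
    finally show ?thesis .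
  qed
  have "sum (int_weight s) A = sum (int_weight s) (A \<inter> {0..}) + sum (int_weight s) (A - {0..})"
    using A by (rule sum.Int_Diff)
  also have "\<dots> \<le> suminf h + suminf h"
    by (intro add_mono half) (auto simp: inj_on_def)
  finally show "sum (int_weight s) A \<le> 2 * suminf h" by simp
qed

text \<open>The triples with x - y + z = m are parametrised by (x, y), with z = m - x + y. The three
  summands are what remains of the triple product when the weight of z, x or y, respectively, is
  taken out.\<close>

definition pair_weight :: "real \<Rightarrow> int \<Rightarrow> int \<times> int \<Rightarrow> real" where
  "pair_weight s m = (\<lambda>(x, y). int_weight s x * int_weight s y +
     int_weight s y * int_weight s (m - x + y) + int_weight s x * int_weight s (m - x + y))"

lemma pair_weight_nonneg: "0 \<le> pair_weight s m p"
  by (auto simp: pair_weight_def split_def intro!: add_nonneg_nonneg mult_nonneg_nonneg less_imp_le[OF int_weight_pos])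

text \<open>If \<open>x - y + z = m\<close>, one of \<open>1 + \<bar>x\<bar>\<close>, \<open>1 + \<bar>y\<bar>\<close>, \<open>1 + \<bar>z\<bar>\<close> is at least a
  third of \<open>1 + \<bar>m\<bar>\<close>; its weight yields the decay in \<open>m\<close> and the two others remain summable.\<close>

lemma int_weight_triple_le:
  assumes "0 \<le> s" and m: "x - y + z = m"
  shows "int_weight s x * int_weight s y * int_weight s z
    \<le> 3 powr s * int_weight s m * pair_weight s m (x, y)"
proof -
  have le: "int_weight s u \<le> 3 powr s * int_weight s m"
    if "1 + \<bar>real_of_int m\<bar> \<le> 3 * (1 + \<bar>real_of_int u\<bar>)" for u
  proof -
    have "(3 * (1 + \<bar>real_of_int u\<bar>)) powr - s \<le> (1 + \<bar>real_of_int m\<bar>) powr - s"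
      using that assms(1) by (intro powr_mono2') auto
    moreover have "(3 * (1 + \<bar>real_of_int u\<bar>)) powr - s = 3 powr - s * int_weight s u"
      unfolding int_weight_def by (rule powr_mult)
    ultimately show ?thesis
      by (simp add: int_weight_def powr_minus field_simps)
  qed
  let ?C = "3 powr s * int_weight s m"
  have pos: "0 \<le> int_weight s u" for u using int_weight_pos[of s u] by simp
  have z: "m - x + y = z" using m by simp
  have "\<bar>real_of_int m\<bar> \<le> \<bar>real_of_int x\<bar> + \<bar>real_of_int y\<bar> + \<bar>real_of_int z\<bar>"
    using m by auto
  then have "1 + \<bar>real_of_int m\<bar> \<le> 3 * (1 + \<bar>real_of_int x\<bar>) \<or>
      1 + \<bar>real_of_int m\<bar> \<le> 3 * (1 + \<bar>real_of_int y\<bar>) \<or>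
      1 + \<bar>real_of_int m\<bar> \<le> 3 * (1 + \<bar>real_of_int z\<bar>)"
    by argo
  then consider "int_weight s x \<le> ?C" | "int_weight s y \<le> ?C" | "int_weight s z \<le> ?C"
    using le by blast
  then have "int_weight s x * int_weight s y * int_weight s z \<le>
    ?C * (int_weight s y * int_weight s z) \<or> int_weight s x * int_weight s y * int_weight s z \<le>
    ?C * (int_weight s x * int_weight s z) \<or> int_weight s x * int_weight s y * int_weight s z \<le>
    ?C * (int_weight s x * int_weight s y)"
  proof cases
    case 1
    then show ?thesis
      using mult_right_mono[OF 1, of "int_weight s y * int_weight s z"] pos by (simp add: mult_ac)
  next
    case 2
    then show ?thesis
      using mult_right_mono[OF 2, of "int_weight s x * int_weight s z"] pos by (simp add: mult_ac)
  next
    case 3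
    then show ?thesis
      using mult_right_mono[OF 3, of "int_weight s x * int_weight s y"] pos by (simp add: mult_ac)
  qed
  moreover have "0 \<le> ?C * (int_weight s u * int_weight s v)" for u v
    using pos by simp
  moreover have "?C * pair_weight s m (x, y) = ?C * (int_weight s x * int_weight s y) +
      ?C * (int_weight s y * int_weight s z) + ?C * (int_weight s x * int_weight s z)"
    by (simp add: pair_weight_def z distrib_left)
  ultimately show ?thesis
    by (smt (verit))
qed

text \<open>Any two of x, y and m - x + y determine the pair (x, y). Hence each of the three
  summands embeds into a full double sum, bounded by the square of \<open>S\<close> uniformly in
  \<open>m\<close>.\<close>

lemma pair_weight_sum_bounded:
  assumes S: "\<And>A. finite A \<Longrightarrow> sum (int_weight s) A \<le> S" and A: "finite A"
  shows "sum (pair_weight s m) A \<le> 3 * S\<^sup>2"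
proof -
  have pos: "0 \<le> int_weight s u" for u using int_weight_pos[of s u] by simp
  have pairs: "(\<Sum>p\<in>A. int_weight s (\<phi> p) * int_weight s (\<psi> p)) \<le> S\<^sup>2"
    if inj: "inj (\<lambda>p. (\<phi> p, \<psi> p))" for \<phi> \<psi> :: "int \<times> int \<Rightarrow> int"
  proof -
    have "(\<Sum>p\<in>A. int_weight s (\<phi> p) * int_weight s (\<psi> p)) =
        (\<Sum>(x, y)\<in>(\<lambda>p. (\<phi> p, \<psi> p)) ` A. int_weight s x * int_weight s y)"
      by (subst sum.reindex) (auto intro: inj_on_subset[OF inj])
    also have "\<dots> \<le> (\<Sum>(x, y)\<in>\<phi> ` A \<times> \<psi> ` A. int_weight s x * int_weight s y)"
      using A pos by (intro sum_mono2) auto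
    also have "\<dots> = sum (int_weight s) (\<phi> ` A) * sum (int_weight s) (\<psi> ` A)"
      by (simp add: sum_product sum.cartesian_product)
    also have "\<dots> \<le> S * S"
      \<comment> \<open>The empty set supplies 0 \<le> \<open>S\<close>.\<close>
      using S A pos S[of "{}"] by (intro mult_mono) (auto intro: sum_nonneg)
    finally show ?thesis by (simp add: power2_eq_square)
  qed
  have "sum (pair_weight s m) A =
      (\<Sum>p\<in>A. int_weight s (fst p) * int_weight s (snd p)) +
      (\<Sum>p\<in>A. int_weight s (snd p) * int_weight s (m - fst p + snd p)) +
      (\<Sum>p\<in>A. int_weight s (fst p) * int_weight s (m - fst p + snd p))"
    by (simp add: pair_weight_def split_def sum.distrib)
  also have "\<dots> \<le> S\<^sup>2 + S\<^sup>2 + S\<^sup>2"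
    by (intro add_mono pairs) (auto simp: inj_on_def)
  finally show ?thesis by simp
qed

section \<open>Product weights on the lattice\<close>

lemma weight_eq_prod:
  "weight \<nu> (\<lambda>j j'. - \<sigma> j j') n =
     (\<Prod>(j, j')\<in>(SIGMA j:UNIV. {1..\<nu> j}). int_weight (\<sigma> j j') (n j j'))"
  by (simp add: weight_def int_weight_def prod.Sigma)

lemma weight_nonneg: "0 \<le> weight \<nu> \<tau> n"
  by (auto simp: weight_def intro!: prod_nonneg)

context
  fixes \<nu> :: "'d::finite \<Rightarrow> nat" and \<sigma> :: "'d \<Rightarrow> nat \<Rightarrow> real"
  assumes \<sigma>: "\<And>j j'. j' \<in> {1..\<nu> j} \<Longrightarrow> 1 < \<sigma> j j'"
begin

abbreviation (input) indices :: "('d \<times> nat) set" where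
  "indices \<equiv> SIGMA j:UNIV. {1..\<nu> j}"

abbreviation (input) W :: "('d \<Rightarrow> nat \<Rightarrow> int) \<Rightarrow> real" where
  "W \<equiv> weight \<nu> (\<lambda>j j'. - \<sigma> j j')"

lemma index_weights_bounded:
  obtains S where "\<And>i. i \<in> indices \<Longrightarrow> 0 < S i"
    and "\<And>i A. i \<in> indices \<Longrightarrow> finite A \<Longrightarrow> sum (int_weight (case_prod \<sigma> i)) A \<le> S i"
proof -
  have "\<exists>S>0. \<forall>A. finite A \<longrightarrow> sum (int_weight (case_prod \<sigma> i)) A \<le> S" if "i \<in> indices" for i
  proof -
    have "1 < case_prod \<sigma> i" using that \<sigma> by auto
    then show ?thesis by (metis int_weight_sum_bounded)
  qed
  then show ?thesis using that by metis
qed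

lemma lattice_eqI:
  assumes "n \<in> index_lattice \<nu>" "n' \<in> index_lattice \<nu>"
    and "\<And>j j'. (j, j') \<in> indices \<Longrightarrow> n j j' = n' j j'"
  shows "n = n'"
proof (intro ext)
  fix j j'
  show "n j j' = n' j j'"
    using assms by (cases "j' \<in> {1..\<nu> j}") (auto simp: index_lattice_def)
qed

text \<open>The weight is a product over coordinates, so its finite partial sums are bounded by the
  product of the one-dimensional bounds; for a nonnegative function this is summability.\<close>

lemma weight_summable: "W summable_on index_lattice \<nu>"
proof (rule nonneg_bdd_above_summable_on)
  obtain S where "\<And>i. i \<in> indices \<Longrightarrow> 0 < S i"
    and S: "\<And>i A. i \<in> indices \<Longrightarrow> finite A \<Longrightarrow> sum (int_weight (case_prod \<sigma> i)) A \<le> S i"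
    using index_weights_bounded by blast
  show "bdd_above (sum W ` {F. F \<subseteq> index_lattice \<nu> \<and> finite F})"
  proof (rule bdd_aboveI2)
    fix F assume F: "F \<in> {F. F \<subseteq> index_lattice \<nu> \<and> finite F}"
    have "sum W F = (\<Sum>n\<in>F. \<Prod>i\<in>indices. int_weight (case_prod \<sigma> i) (case_prod n i))"
      by (simp add: weight_eq_prod split_def)
    also have "\<dots> \<le> (\<Prod>i\<in>indices. S i)"
    proof (rule sum_prod_le_prod_bound[where f = "\<lambda>i. int_weight (case_prod \<sigma> i)" and \<phi> = case_prod])
      show "inj_on (\<lambda>n. restrict (case_prod n) indices) F"
      proof (rule inj_onI)
        fix n n' assume nn: "n \<in> F" "n' \<in> F"
          and eq: "restrict (case_prod n) indices = restrict (case_prod n') indices"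
        show "n = n'"
        proof (rule lattice_eqI)
          show "n j j' = n' j j'" if "(j, j') \<in> indices" for j j'
            using fun_cong[OF eq, of "(j, j')"] that by simp
        qed (use F nn in auto)
      qed
      show "finite indices" by simp
    qed (use F S in \<open>auto intro: less_imp_le[OF int_weight_pos]\<close>)
    finally show "sum W F \<le> (\<Prod>i\<in>indices. S i)" .
  qed
qed (rule weight_nonneg)

text \<open>The one-dimensional convolution estimate is applied in every coordinate and the results
  are multiplied. Bounding finite sums first yields summability and the bound on the infinite sum
  together.\<close>

lemma weight_product_sum_bounded:
  obtains K where "0 < K" and "\<And>n F. finite F \<Longrightarrow> F \<subseteq> convolution_triples \<nu> n \<Longrightarrow>
    sum (weight_product W) F \<le> K * W n"
proof -
  obtain S where S_pos: "\<And>i. i \<in> indices \<Longrightarrow> 0 < S i"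
    and S: "\<And>i A. i \<in> indices \<Longrightarrow> finite A \<Longrightarrow> sum (int_weight (case_prod \<sigma> i)) A \<le> S i"
    using index_weights_bounded by blast
  define C where "C n i = 3 powr case_prod \<sigma> i * int_weight (case_prod \<sigma> i) (case_prod n i)" for n i
  define f where "f n i y = C n i * pair_weight (case_prod \<sigma> i) (case_prod n i) y" for n i y
  \<comment> \<open>The third lattice point is dropped, since the convolution constraint recovers
    it.\<close>
  define \<phi> :: "('d \<Rightarrow> nat \<Rightarrow> int) \<times> ('d \<Rightarrow> nat \<Rightarrow> int) \<times> ('d \<Rightarrow> nat \<Rightarrow> int) \<Rightarrow> 'd \<times> nat \<Rightarrow> int \<times> int"
    where "\<phi> = (\<lambda>(x, y, z) i. (case_prod x i, case_prod y i))"
  \<comment> \<open>Per coordinate, the power of 3 is the price of comparing a weight with that of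
    \<open>n\<close>, and 3 S^2 bounds the sum of the pair weights.\<close>
  define K where "K = (\<Prod>i\<in>indices. 3 powr case_prod \<sigma> i * (3 * (S i)\<^sup>2))"
  have C_nonneg: "0 \<le> C n i" for n i
    using int_weight_pos by (simp add: C_def less_imp_le)
  show ?thesis
  proof (rule that)
    show "0 < K"
      unfolding K_def using S_pos by (intro prod_pos) force
    fix n F assume F: "finite F" "F \<subseteq> convolution_triples \<nu> n"
    have "weight_product W p \<le> (\<Prod>i\<in>indices. f n i (\<phi> p i))" if p: "p \<in> F" for p
    proof -
      obtain x y z where p_eq: "p = (x, y, z)" and xyz: "\<And>j j'. x j j' - y j j' + z j j' = n j j'"
        using p F(2) by (auto simp: convolution_triples_def)
      have "weight_product W p = (\<Prod>i\<in>indices. int_weight (case_prod \<sigma> i) (case_prod x i) *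
          int_weight (case_prod \<sigma> i) (case_prod y i) * int_weight (case_prod \<sigma> i) (case_prod z i))"
        by (simp add: p_eq weight_product_def weight_eq_prod prod.distrib split_def)
      also have "\<dots> \<le> (\<Prod>i\<in>indices. f n i (\<phi> p i))"
      proof (rule prod_mono)
        fix i assume i: "i \<in> indices"
        then have "0 \<le> case_prod \<sigma> i" using \<sigma> by force
        then show "0 \<le> int_weight (case_prod \<sigma> i) (case_prod x i) *
            int_weight (case_prod \<sigma> i) (case_prod y i) * int_weight (case_prod \<sigma> i) (case_prod z i) \<and>
          int_weight (case_prod \<sigma> i) (case_prod x i) *
            int_weight (case_prod \<sigma> i) (case_prod y i) * int_weight (case_prod \<sigma> i) (case_prod z i)
          \<le> f n i (\<phi> p i)"
          using int_weight_triple_le[of "case_prod \<sigma> i" "case_prod x i" "case_prod y i"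
              "case_prod z i" "case_prod n i"] xyz
          by (simp add: f_def C_def \<phi>_def p_eq split_def less_imp_le[OF int_weight_pos])
      qed
      finally show ?thesis .
    qed
    then have "sum (weight_product W) F \<le> (\<Sum>p\<in>F. \<Prod>i\<in>indices. f n i (\<phi> p i))"
      by (rule sum_mono)
    also have "\<dots> \<le> (\<Prod>i\<in>indices. C n i * (3 * (S i)\<^sup>2))"
    proof (rule sum_prod_le_prod_bound[where f = "f n" and \<phi> = \<phi>])
      show "inj_on (\<lambda>p. restrict (\<phi> p) indices) F"
      proof (rule inj_onI)
        fix p p' assume pp: "p \<in> F" "p' \<in> F"
          and eq: "restrict (\<phi> p) indices = restrict (\<phi> p') indices"
        obtain x y z where p: "p = (x, y, z)" and xyz: "\<And>j j'. x j j' - y j j' + z j j' = n j j'"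
          and L: "x \<in> index_lattice \<nu>" "y \<in> index_lattice \<nu>"
          using pp(1) F(2) by (auto simp: convolution_triples_def)
        obtain x' y' z' where p': "p' = (x', y', z')"
          and xyz': "\<And>j j'. x' j j' - y' j j' + z' j j' = n j j'"
          and L': "x' \<in> index_lattice \<nu>" "y' \<in> index_lattice \<nu>"
          using pp(2) F(2) by (auto simp: convolution_triples_def)
        have "x j j' = x' j j' \<and> y j j' = y' j j'" if "(j, j') \<in> indices" for j j'
          using fun_cong[OF eq, of "(j, j')"] that by (simp add: p p' \<phi>_def)
        then have xy: "x = x'" "y = y'"
          using L L' by (blast intro: lattice_eqI)+
        \<comment> \<open>The convolution identity holds at every (j, j'), also outside
          \<open>indices\<close>, so equality of the first two components settles the third
          everywhere.\<close>
        have "z = z'"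
        proof (intro ext)
          show "z j j' = z' j j'" for j j'
            using xyz[of j j'] xyz'[of j j'] by (simp add: xy)
        qed
        with xy show "p = p'" by (simp add: p p')
      qed
      show "sum (f n i) A \<le> C n i * (3 * (S i)\<^sup>2)" if "i \<in> indices" "finite A" for i A
        unfolding f_def sum_distrib_left[symmetric]
        using that S C_nonneg by (intro mult_left_mono pair_weight_sum_bounded)
      show "0 \<le> f n i y" for i y
        unfolding f_def using C_nonneg pair_weight_nonneg by simp
    qed (use F in auto)
    also have "\<dots> = K * W n"
      by (simp add: C_def K_def weight_eq_prod prod.distrib split_def mult_ac)
    finally show "sum (weight_product W) F \<le> K * W n" .
  qed
qed

lemma weight_cubic_weight: obtains K where "0 < K" and "cubic_weight \<nu> W K"
proof -
  obtain K where K: "0 < K" and bound: "\<And>n F. finite F \<Longrightarrow> F \<subseteq> convolution_triples \<nu> n \<Longrightarrow>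
      sum (weight_product W) F \<le> K * W n"
    using weight_product_sum_bounded by blast
  have summable: "weight_product W summable_on convolution_triples \<nu> n" for n
  proof (rule nonneg_bdd_above_summable_on)
    show "bdd_above (sum (weight_product W) ` {F. F \<subseteq> convolution_triples \<nu> n \<and> finite F})"
      by (rule bdd_aboveI2[of _ _ "K * W n"]) (use bound in auto)
  qed (auto simp: weight_product_def weight_nonneg)
  have "cubic_weight \<nu> W K"
    by unfold_locales (use K weight_nonneg summable infsum_le_finite_sums[OF summable bound] in auto)
  with K show ?thesis by (rule that)
qed

end

section \<open>The random datum and the proof of the theorem\<close>

text \<open>The decay of the coefficients times the allowed growth of the Gaussians leaves exponent
  -(\<rho> - \<kappa>), which is at most half of itself because it is nonpositive and every base is
  at least 1.\<close>

lemma weight_datum_le: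
  assumes "\<And>j j'. j' \<in> {1..\<nu> j} \<Longrightarrow> 0 \<le> \<rho> j j' - \<kappa> j j'"
  shows "weight \<nu> (\<lambda>j j'. - \<rho> j j') n * weight \<nu> \<kappa> n
    \<le> weight \<nu> (\<lambda>j j'. - ((\<rho> j j' - \<kappa> j j') / 2)) n"
proof -
  have "weight \<nu> (\<lambda>j j'. - \<rho> j j') n * weight \<nu> \<kappa> n = weight \<nu> (\<lambda>j j'. - \<rho> j j' + \<kappa> j j') n"
    by (simp only: weight_def prod.distrib powr_add)
  also have "\<dots> \<le> weight \<nu> (\<lambda>j j'. - ((\<rho> j j' - \<kappa> j j') / 2)) n"
    unfolding weight_def using assms
    by (intro prod_mono conjI prod_nonneg powr_mono) (auto simp: field_simps)
  finally show ?thesis .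
qed

theorem theorem3p1:
  fixes \<nu> :: "'d::finite \<Rightarrow> nat"
    and \<omega> \<rho> \<kappa> :: "'d \<Rightarrow> nat \<Rightarrow> real"
    and c :: "('d \<Rightarrow> nat \<Rightarrow> int) \<Rightarrow> complex"
    and M :: "'w measure"
    and g :: "('d \<Rightarrow> nat \<Rightarrow> int) \<Rightarrow> 'w \<Rightarrow> complex"
    and \<alpha> \<mu>\<^sub>1 \<mu>\<^sub>2 \<mu>\<^sub>3 \<eta> a :: real
  assumes "\<And>j. \<nu> j \<ge> 1"
    and "(\<Sum>j\<in>UNIV. \<nu> j) > CARD('d)"
    and "\<And>j. rationally_independent (\<nu> j) (\<omega> j)"
    and "\<And>j j'. j' \<in> {1..\<nu> j} \<Longrightarrow> \<rho> j j' > 0"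
    and "\<And>n. n \<in> index_lattice \<nu> \<Longrightarrow> cmod (c n) \<le> weight \<nu> (\<lambda>j j'. - \<rho> j j') n"
    and "prob_space M"
    and "prob_space.indep_vars M (\<lambda>_. borel) g (index_lattice \<nu>)"
    and "\<And>n. n \<in> index_lattice \<nu> \<Longrightarrow> std_complex_gaussian M (g n)"
    and "\<alpha> > 1"
    and "\<And>j j'. j' \<in> {1..\<nu> j} \<Longrightarrow> \<kappa> j j' > 0"
    and "\<And>j j'. j' \<in> {1..\<nu> j} \<Longrightarrow> \<rho> j j' - \<kappa> j j' > 2"
    and "0 < \<mu>\<^sub>1" and "\<mu>\<^sub>1 < 1 / real (\<Sum>j\<in>UNIV. \<nu> j)"
    and "0 < \<mu>\<^sub>2" and "\<mu>\<^sub>2 < 1"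
    and "0 < \<mu>\<^sub>3" and "\<mu>\<^sub>3 < 1"
    and "0 \<le> \<eta>"
    and "\<eta> < min (2 * (1 / real (\<Sum>j\<in>UNIV. \<nu> j) - \<mu>\<^sub>1) * eta2 \<nu> \<rho> \<kappa> - \<mu>\<^sub>2) (eta3 \<alpha> \<mu>\<^sub>3)"
    and "a \<ge> 1"
  shows "\<exists>\<epsilon>\<^sub>0>0. \<exists>c0>0. \<exists>C>0.
    \<forall>\<epsilon> \<delta> w. 0 < \<epsilon> \<and> \<epsilon> < \<epsilon>\<^sub>0 \<and>
      inverse a * \<epsilon> powr (1 + \<eta>) \<le> \<delta> \<and> \<delta> \<le> a * \<epsilon> powr (1 + \<eta>) \<and>
      w \<in> space M - exceptional_set M \<nu> \<kappa> g \<delta> \<longrightarrow>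
      (\<exists>T u ct. T = c0 * \<epsilon> powr (- \<alpha> + 1 + \<eta>) \<and>
        qp_nls_solution \<nu> \<omega> \<alpha> \<epsilon> (\<lambda>n. c n * g n w) T u ct \<and>
        (\<forall>n\<in>index_lattice \<nu>. \<forall>t\<in>{0..T}.
           cmod (ct t n) \<le> C * \<epsilon> powr (- 1 / 2 - \<eta> / 2) *
             weight \<nu> (\<lambda>j j'. - ((\<rho> j j' - \<kappa> j j') / 2)) n))"
proof -
  define \<sigma> where "\<sigma> j j' = (\<rho> j j' - \<kappa> j j') / 2" for j j'
  define W where "W = weight \<nu> (\<lambda>j j'. - \<sigma> j j')"
  \<comment> \<open>Halving the condition \<rho> - \<kappa> > 2 gives exactly the exponent range in
    which the one-dimensional weights are summable.\<close>
  have \<sigma>: "1 < \<sigma> j j'" if "j' \<in> {1..\<nu> j}" for j j'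
    using assms(11)[OF that] by (simp add: \<sigma>_def)
  obtain K where K: "0 < K" and "cubic_weight \<nu> W K"
    unfolding W_def using weight_cubic_weight[of \<nu> \<sigma>] \<sigma> by blast
  then interpret cubic_weight \<nu> W K by simp
  have W_summable: "W summable_on index_lattice \<nu>"
    unfolding W_def using \<sigma> by (rule weight_summable)
  have a: "0 < a" using assms(20) by simp
  \<comment> \<open>Chosen so that the smallness condition of the fixed point becomes an
    equality.\<close>
  define c0 where "c0 = 1 / (24 * a * K)"
  have c0: "0 < c0" using a K by (simp add: c0_def)
  have solution: "\<exists>T u ct. T = c0 * \<epsilon> powr (- \<alpha> + 1 + \<eta>) \<and>
        qp_nls_solution \<nu> \<omega> \<alpha> \<epsilon> (\<lambda>n. c n * g n w) T u ct \<and>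
        (\<forall>n\<in>index_lattice \<nu>. \<forall>t\<in>{0..T}.
           cmod (ct t n) \<le> (2 * sqrt a) * \<epsilon> powr (- 1 / 2 - \<eta> / 2) *
             weight \<nu> (\<lambda>j j'. - ((\<rho> j j' - \<kappa> j j') / 2)) n)"
    if \<epsilon>: "0 < \<epsilon>" and \<delta>: "inverse a * \<epsilon> powr (1 + \<eta>) \<le> \<delta>"
      and w: "w \<in> space M - exceptional_set M \<nu> \<kappa> g \<delta>" for \<epsilon> \<delta> w
  proof -
    define B where "B = sqrt a * \<epsilon> powr (- 1 / 2 - \<eta> / 2)"
    define T where "T = c0 * \<epsilon> powr (- \<alpha> + 1 + \<eta>)"
    define b where "b n = c n * g n w" for n
    have B: "0 \<le> B" using a by (simp add: B_def)
    have T: "0 \<le> T" using c0 by (simp add: T_def)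
    have "inverse a * \<epsilon> powr (1 + \<eta>) = a powr - 1 * \<epsilon> powr (1 + \<eta>)"
      using a by (simp add: powr_minus)
    moreover have "- 1 * (- 1 / 2) = (1 / 2 :: real)" "(1 + \<eta>) * (- 1 / 2) = - 1 / 2 - \<eta> / 2"
      by (simp_all add: field_simps)
    ultimately have "(inverse a * \<epsilon> powr (1 + \<eta>)) powr (- 1 / 2) =
        a powr (1 / 2) * \<epsilon> powr (- 1 / 2 - \<eta> / 2)"
      by (simp only: powr_mult powr_powr)
    also have "\<dots> = B"
      using a by (simp add: B_def powr_half_sqrt)
    \<comment> \<open>A negative power is decreasing, so the lower bound on \<delta> becomes an
      upper bound on its power -1/2; this is the origin of \<open>B\<close>.\<close>
    finally have \<delta>_B: "\<delta> powr (- 1 / 2) \<le> B"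
      using powr_mono2'[OF _ _ \<delta>, of "- 1 / 2"] a \<epsilon> by simp
    have "bounded_by B b"
      unfolding bounded_by_def
    proof
      fix n assume n: "n \<in> index_lattice \<nu>"
      have "cmod (g n w) \<le> \<delta> powr (- 1 / 2) * weight \<nu> \<kappa> n"
        using w n by (auto simp: exceptional_set_def not_less)
      also have "\<dots> \<le> B * weight \<nu> \<kappa> n"
        using \<delta>_B by (intro mult_right_mono weight_nonneg)
      finally have "cmod (b n) \<le> weight \<nu> (\<lambda>j j'. - \<rho> j j') n * (B * weight \<nu> \<kappa> n)"
        unfolding b_def norm_mult using assms(5)[OF n] by (intro mult_mono weight_nonneg) auto
      also have "\<dots> = B * (weight \<nu> (\<lambda>j j'. - \<rho> j j') n * weight \<nu> \<kappa> n)"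
        by simp
      also have "\<dots> \<le> B * W n"
        unfolding W_def \<sigma>_def using B assms(11)
        by (intro mult_left_mono weight_datum_le) force+
      finally show "cmod (b n) \<le> B * W n" .
    qed
    moreover have "24 * \<epsilon> powr \<alpha> * T * B\<^sup>2 * K \<le> 1"
    proof -
      have "(\<epsilon> powr (- 1 / 2 - \<eta> / 2))\<^sup>2 = \<epsilon> powr (- 1 - \<eta>)"
        unfolding power2_eq_square powr_add[symmetric] by (rule arg_cong[where f = "(powr) \<epsilon>"]) simp
      then have "B\<^sup>2 = a * \<epsilon> powr (- 1 - \<eta>)"
        using a by (simp add: B_def power_mult_distrib)
      then have "24 * \<epsilon> powr \<alpha> * T * B\<^sup>2 * K = (24 * a * K * c0) *
          (\<epsilon> powr \<alpha> * \<epsilon> powr (- \<alpha> + 1 + \<eta>) * \<epsilon> powr (- 1 - \<eta>))"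
        by (simp add: T_def)
      \<comment> \<open>The exponents \<alpha>, -\<alpha> + 1 + \<eta> and -1 - \<eta> add up to
        zero, which is why this power of \<epsilon> is the right time scale.\<close>
      moreover have "\<epsilon> powr \<alpha> * \<epsilon> powr (- \<alpha> + 1 + \<eta>) * \<epsilon> powr (- 1 - \<eta>) = 1"
        using \<epsilon> by (simp flip: powr_add)
      moreover have "24 * a * K * c0 = 1"
        using a K by (simp add: c0_def)
      ultimately show ?thesis
        by (simp only: mult_1_left order.refl)
    qed
    ultimately obtain ct where ct: "admissible T (2 * B) ct"
      and eq: "\<And>t n. t \<in> {0..T} \<Longrightarrow> n \<in> index_lattice \<nu> \<Longrightarrow>
        ct t n = duhamel \<nu> \<omega> (\<epsilon> powr \<alpha>) b ct t n"
      using duhamel_fixed_point[of B b "\<epsilon> powr \<alpha>" T \<omega>] B T by auto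
    have R: "0 \<le> 2 * B" using B by simp
    have bounded: "bounded_by (2 * B) (ct t)" if "t \<in> {0..T}" for t
      using ct that by (simp add: admissible_def)
    define u where "u t x = (\<Sum>\<^sub>\<infinity>n\<in>index_lattice \<nu>. ct t n * cis (phase \<nu> \<omega> n x))" for t x
    have u: "((\<lambda>n. ct t n * cis (phase \<nu> \<omega> n x)) has_sum u t x) (index_lattice \<nu>)"
      if t: "t \<in> {0..T}" for t x
      unfolding u_def
    proof (rule has_sum_infsum, rule Infinite_Sum.abs_summable_summable,
        rule Infinite_Sum.abs_summable_on_comparison_test')
      show "(\<lambda>n. 2 * B * W n) summable_on index_lattice \<nu>"
        by (intro summable_on_cmult_right W_summable)
    qed (use bounded_byD[OF bounded[OF t]] in \<open>simp add: norm_mult\<close>)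
    \<comment> \<open>At time 0 the phase is 1 and the integral runs over a single point, so the
      fixed point equation returns the datum.\<close>
    have ct_0: "ct 0 n = b n" if "n \<in> index_lattice \<nu>" for n
      using eq[of 0 n] that T by (simp add: duhamel_def)
    have "qp_nls_solution \<nu> \<omega> \<alpha> \<epsilon> b T u ct"
      unfolding qp_nls_solution_def
    proof (intro conjI ballI allI)
      show "((\<lambda>n. b n * cis (phase \<nu> \<omega> n x)) has_sum u 0 x) (index_lattice \<nu>)" for x
        using u[of 0 x] T by (simp add: ct_0 cong: has_sum_cong)
      fix t n assume t: "t \<in> {0..T}" and n: "n \<in> index_lattice \<nu>"
      show "cubic_term (ct t) summable_on convolution_triples \<nu> n"
        using bounded[OF t] R n by (rule cubic_term_summable)
      show "(\<lambda>s. cis (- dispersion \<nu> \<omega> n * (t - s)) * cubic_sum \<nu> (ct s) n)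
          absolutely_integrable_on {0..t}"
        using ct R n t by (intro absolutely_integrable_continuous_real continuous_on_integrand)
      show "ct t n = cis (- dispersion \<nu> \<omega> n * t) * b n +
          \<i> * complex_of_real (\<epsilon> powr \<alpha>) *
          integral {0..t} (\<lambda>s. cis (- dispersion \<nu> \<omega> n * (t - s)) * cubic_sum \<nu> (ct s) n)"
        using eq[OF t n] unfolding duhamel_def .
    qed (rule u)
    moreover have "cmod (ct t n) \<le> (2 * sqrt a) * \<epsilon> powr (- 1 / 2 - \<eta> / 2) *
        weight \<nu> (\<lambda>j j'. - ((\<rho> j j' - \<kappa> j j') / 2)) n"
      if "n \<in> index_lattice \<nu>" "t \<in> {0..T}" for n t
      using bounded_byD[OF bounded[OF that(2)] that(1)] by (simp add: B_def W_def \<sigma>_def)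
    ultimately show ?thesis
      using T_def unfolding b_def by blast
  qed
  show ?thesis
  \<comment> \<open>The constant 2 \<open>sqrt a\<close> comes from the ball radius 2B; like the
    threshold 1 and \<open>c0\<close>, it is independent of \<epsilon>, \<delta> and
    \<open>w\<close>.\<close>
  proof (rule exI[of _ 1], rule conjI[OF zero_less_one], rule exI[of _ c0], rule conjI[OF c0],
      rule exI[of _ "2 * sqrt a"], rule conjI)
    show "0 < 2 * sqrt a" using a by simp
  qed (intro allI impI, elim conjE, rule solution)
qed

end
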